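(* An entire function $f$ is in $\mathcal{F}_2$ if and only if it satisfies the two conditions $$f(x+y)-f(x-y)\ge 0\quad\forall\, x,y\ge 0,\tag{A}$$ $$(x+y-z)f(x-y)+(z-x+y)f(x+y)\ge 0\quad\forall\, x\ge z\ge 0,\ y\ge x-z,\tag{B}$$ or, equivalently, if and only if $f$ satisfies (A) and the condition $$(x+y)f(x-y)+(y-x)f(x+y)\ge 0\quad\forall\, y\ge x\ge 0.\tag{C}$$
   Context: $\mathcal{F}_2$ is the class of entire functions $f$ such that $f(A)$ is entrywise nonnegative for every entrywise nonnegative $A\in\mathbb{R}^{2\times 2}$, where for $f(z)=\sum_{j\ge0}a_jz^j$ one has $f(A)=\sum_{j\ge0}a_jA^j$. The variables $x,y,z$ are real. Inequalities "$\ge 0$" for complex-valued expressions mean real and nonnegative. *)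

theory Defs
  imports "HOL-Complex_Analysis.Complex_Analysis" "HOL-Library.Complex_Order"
begin

text \<open>
  The order on \<^typ>\<open>complex\<close> is the one of \<^theory>\<open>HOL-Library.Complex_Order\<close>:
  \<^prop>\<open>0 \<le> (w::complex)\<close> says that \<^term>\<open>w\<close> is real and nonnegative.
\<close>

text \<open>
  The class instance of \<^term>\<open>(^)\<close> on \<^typ>\<open>real^'n^'n\<close> is the entrywise power, hence
  a separate power with respect to the matrix product.
\<close>

primrec matpow :: "'a::semiring_1^'n^'n \<Rightarrow> nat \<Rightarrow> 'a^'n^'n" where
  "matpow A 0 = mat 1"
| "matpow A (Suc j) = A ** matpow A j"

definition matfun :: "(complex \<Rightarrow> complex) \<Rightarrow> real^'n^'n \<Rightarrow> complex^'n^'n" where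
  "matfun f A = (\<Sum>j. \<chi> i k. fps_nth (fps_expansion f 0) j * of_real (matpow A j $ i $ k))"

definition F2 :: "(complex \<Rightarrow> complex) set" where
  "F2 = {f. f holomorphic_on UNIV \<and>
     (\<forall>A::real^2^2. (\<forall>i k. 0 \<le> A $ i $ k) \<longrightarrow> (\<forall>i k. 0 \<le> matfun f A $ i $ k))}"

definition cond_A :: "(complex \<Rightarrow> complex) \<Rightarrow> bool" where
  "cond_A f \<longleftrightarrow> (\<forall>x y :: real. x \<ge> 0 \<and> y \<ge> 0 \<longrightarrow>
     f (of_real (x + y)) - f (of_real (x - y)) \<ge> 0)"

definition cond_B :: "(complex \<Rightarrow> complex) \<Rightarrow> bool" where
  "cond_B f \<longleftrightarrow> (\<forall>x y z :: real. x \<ge> z \<and> z \<ge> 0 \<and> y \<ge> x - z \<longrightarrow>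
     of_real (x + y - z) * f (of_real (x - y)) + of_real (z - x + y) * f (of_real (x + y)) \<ge> 0)"

definition cond_C :: "(complex \<Rightarrow> complex) \<Rightarrow> bool" where
  "cond_C f \<longleftrightarrow> (\<forall>x y :: real. y \<ge> x \<and> x \<ge> 0 \<longrightarrow>
     of_real (x + y) * f (of_real (x - y)) + of_real (y - x) * f (of_real (x + y)) \<ge> 0)"

text \<open>
  For entire functions the coefficients above are those of the power series of \<^term>\<open>f\<close>,
  and the series defining \<^const>\<open>matfun\<close> converges, so no unspecified values occur.
\<close>

lemma entire_power_series:
  assumes "f holomorphic_on UNIV"
  shows "(\<lambda>j. fps_nth (fps_expansion f 0) j * z ^ j) sums f z"
proof -
  have "(\<lambda>j. (deriv ^^ j) f 0 / fact j * (z - 0) ^ j) sums f z"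
    by (rule holomorphic_power_series[where r = "norm z + 1"])
       (use assms in \<open>auto intro: holomorphic_on_subset\<close>)
  then show ?thesis by (simp add: fps_expansion_def)
qed

lemma matpow_entry_bound:
  fixes A :: "real^'n^'n"
  assumes "\<And>i k. \<bar>A $ i $ k\<bar> \<le> c"
  shows "\<bar>matpow A j $ i $ k\<bar> \<le> (real CARD('n) * c) ^ j"
proof (induction j arbitrary: i k)
  case 0
  show ?case by (simp add: mat_def)
next
  case (Suc j)
  have c: "c \<ge> 0" using assms[of i k] by linarith
  have "\<bar>matpow A (Suc j) $ i $ k\<bar> = \<bar>\<Sum>l\<in>UNIV. A $ i $ l * matpow A j $ l $ k\<bar>"
    by (simp add: matrix_matrix_mult_def)
  also have "\<dots> \<le> (\<Sum>l\<in>UNIV. \<bar>A $ i $ l\<bar> * \<bar>matpow A j $ l $ k\<bar>)"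
    by (metis (no_types, lifting) abs_mult sum.cong sum_abs)
  also have "\<dots> \<le> (\<Sum>l\<in>(UNIV::'n set). c * (real CARD('n) * c) ^ j)"
    by (intro sum_mono mult_mono assms Suc.IH) (use c in auto)
  finally show ?case by (simp add: mult.assoc)
qed

lemma summable_matfun_entry:
  fixes A :: "real^'n^'n"
  assumes "f holomorphic_on UNIV"
  shows "summable (\<lambda>j. fps_nth (fps_expansion f 0) j * complex_of_real (matpow A j $ i $ k))"
proof -
  define c where "c = (\<Sum>i\<in>UNIV. \<Sum>k\<in>UNIV. \<bar>A $ i $ k\<bar>)"
  have A: "\<bar>A $ i $ k\<bar> \<le> c" for i k
  proof -
    have "\<bar>A $ i $ k\<bar> \<le> (\<Sum>k\<in>UNIV. \<bar>A $ i $ k\<bar>)"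
      by (rule member_le_sum) auto
    also have "\<dots> \<le> c"
      unfolding c_def by (rule member_le_sum) (auto intro: sum_nonneg)
    finally show ?thesis .
  qed
  define r where "r = real CARD('n) * c"
  have "c \<ge> 0" by (simp add: c_def sum_nonneg)
  then have r: "r \<ge> 0" by (simp add: r_def)
  have "summable (\<lambda>j. fps_nth (fps_expansion f 0) j * complex_of_real (r + 1) ^ j)"
    using entire_power_series[OF assms] by (rule sums_summable)
  then have "summable (\<lambda>j. norm (fps_nth (fps_expansion f 0) j * complex_of_real r ^ j))"
    by (rule powser_insidea) (use r in \<open>simp del: of_real_add\<close>)
  then show ?thesis
  proof (rule summable_comparison_test'[where N = 0])
    fix j :: nat
    show "norm (fps_nth (fps_expansion f 0) j * complex_of_real (matpow A j $ i $ k))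
        \<le> norm (fps_nth (fps_expansion f 0) j * complex_of_real r ^ j)"
      using matpow_entry_bound[OF A, of j i k] r \<open>c \<ge> 0\<close>
      by (auto simp: norm_mult norm_power r_def intro!: mult_left_mono)
  qed
qed

lemma matfun_entry:
  fixes A :: "real^'n^'n"
  assumes "f holomorphic_on UNIV"
  shows "matfun f A $ i $ k =
    (\<Sum>j. fps_nth (fps_expansion f 0) j * complex_of_real (matpow A j $ i $ k))"
proof -
  define S where "S = (\<chi> i k. \<Sum>j. fps_nth (fps_expansion f 0) j *
    complex_of_real (matpow A j $ i $ k))"
  have "(\<lambda>j. \<chi> i k. fps_nth (fps_expansion f 0) j * complex_of_real (matpow A j $ i $ k)) sums S"
    unfolding sums_def
    by (intro vec_tendstoI)
       (simp add: S_def summable_LIMSEQ summable_matfun_entry[OF assms])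
  then show ?thesis by (simp add: matfun_def sums_unique[symmetric] S_def)
qed

end

theory Submission
  imports Defs
begin

text \<open>
  A nonnegative \<open>2 \<times> 2\<close> matrix with diagonal \<open>a, d\<close> has real eigenvalues \<open>x \<plusminus> y\<close> with
  \<open>x = (a + d) / 2\<close> and \<open>y \<ge> \<bar>a - d\<bar> / 2\<close>. Interpolating \<open>f\<close> at the eigenvalues turns
  nonnegativity of the off-diagonal entries of \<open>f(A)\<close> into (A), and nonnegativity of the
  entry at \<open>a = z\<close> into the inequality (B). The latter is affine in \<open>z\<close>, with slope
  \<open>f(x + y) - f(x - y) \<ge> 0\<close> by (A), so only the least admissible \<open>z\<close> matters: it is \<open>0\<close>
  for \<open>y \<ge> x\<close>, which is (C), and \<open>x - y\<close> otherwise, which is \<open>f(x - y) \<ge> 0\<close>. A double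
  eigenvalue is treated by the derivative of \<open>f\<close>.
\<close>

section \<open>Powers of a 2 x 2 matrix in terms of its eigenvalues\<close>

text \<open>Cayley-Hamilton in factored form \<open>(A - m) (A - l) = 0\<close>: trace and
  determinant make \<open>l\<close> and \<open>m\<close> the roots of the characteristic
  polynomial.\<close>

lemma matrix_2_mult_sub_eigenvalue:
  fixes A :: "real^2^2"
  assumes tr: "l + m = A $ 1 $ 1 + A $ 2 $ 2"
    and det: "l * m = A $ 1 $ 1 * A $ 2 $ 2 - A $ 1 $ 2 * A $ 2 $ 1"
  shows "(\<Sum>h\<in>UNIV. A $ i $ h * (A - mat l) $ h $ k) = m * (A - mat l) $ i $ k"
proof -
  have m: "m = A $ 1 $ 1 + A $ 2 $ 2 - l" using tr by simp
  show ?thesis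
    using exhaust_2[of i] exhaust_2[of k] det unfolding m
    by (auto simp: sum_2 mat_def algebra_simps)
qed

text \<open>Lagrange interpolation of the \<open>j\<close>-th power at \<open>l\<close> and
  \<open>m\<close>. Clearing the denominator \<open>m - l\<close> avoids assuming distinct
  eigenvalues; for \<open>l = m\<close> both sides vanish.\<close>

lemma matpow_2_eigenvalues:
  fixes A :: "real^2^2"
  assumes tr: "l + m = A $ 1 $ 1 + A $ 2 $ 2"
    and det: "l * m = A $ 1 $ 1 * A $ 2 $ 2 - A $ 1 $ 2 * A $ 2 $ 1"
  shows "(m - l) * matpow A j $ i $ k =
    (A - mat l) $ i $ k * m ^ j - (A - mat m) $ i $ k * l ^ j"
proof (induction j arbitrary: i k)
  case 0
  show ?case by (simp add: mat_def)
next
  case (Suc j)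
  have CH: "(\<Sum>h\<in>UNIV. A $ i $ h * (A - mat l) $ h $ k) = m * (A - mat l) $ i $ k"
       "(\<Sum>h\<in>UNIV. A $ i $ h * (A - mat m) $ h $ k) = l * (A - mat m) $ i $ k"
    using matrix_2_mult_sub_eigenvalue[of l m A] matrix_2_mult_sub_eigenvalue[of m l A] tr det
    by (simp_all add: ac_simps)
  have "(m - l) * matpow A (Suc j) $ i $ k
      = (\<Sum>h\<in>UNIV. A $ i $ h * ((m - l) * matpow A j $ h $ k))"
    by (simp add: matrix_matrix_mult_def sum_distrib_left mult_ac)
  also have "\<dots> = (\<Sum>h\<in>UNIV. A $ i $ h * (A - mat l) $ h $ k) * m ^ j
      - (\<Sum>h\<in>UNIV. A $ i $ h * (A - mat m) $ h $ k) * l ^ j"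
    unfolding Suc.IH sum_distrib_right sum_subtractf[symmetric]
    by (intro sum.cong) (auto simp: algebra_simps)
  finally show ?case unfolding CH by simp
qed

text \<open>The confluent case: \<open>(A - l)\<close> squares to zero, so the binomial expansion of
  the power of \<open>l + (A - l)\<close> stops after its linear term.\<close>

lemma matpow_2_double_eigenvalue:
  fixes A :: "real^2^2"
  assumes tr: "l + l = A $ 1 $ 1 + A $ 2 $ 2"
    and det: "l * l = A $ 1 $ 1 * A $ 2 $ 2 - A $ 1 $ 2 * A $ 2 $ 1"
  shows "matpow A j $ i $ k =
    mat 1 $ i $ k * l ^ j + (A - mat l) $ i $ k * (real j * l ^ (j - 1))"
proof (induction j arbitrary: i k)
  case 0
  show ?case by simp
next
  case (Suc j)
  have CH: "(\<Sum>h\<in>UNIV. A $ i $ h * (A - mat l) $ h $ k) = l * (A - mat l) $ i $ k"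
    by (rule matrix_2_mult_sub_eigenvalue[OF tr det])
  have A: "(\<Sum>h\<in>UNIV. A $ i $ h * mat 1 $ h $ k) = l * mat 1 $ i $ k + (A - mat l) $ i $ k"
    using exhaust_2[of i] exhaust_2[of k] by (auto simp: sum_2 mat_def)
  have "matpow A (Suc j) $ i $ k
      = (\<Sum>h\<in>UNIV. A $ i $ h * mat 1 $ h $ k) * l ^ j
      + (\<Sum>h\<in>UNIV. A $ i $ h * (A - mat l) $ h $ k) * (real j * l ^ (j - 1))"
    unfolding sum_distrib_right sum.distrib[symmetric]
    by (simp add: matrix_matrix_mult_def Suc.IH algebra_simps)
  also have "\<dots> = mat 1 $ i $ k * l ^ Suc j
      + (A - mat l) $ i $ k * (l ^ j + real j * (l * l ^ (j - 1)))"
    unfolding A CH by (simp add: algebra_simps)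
  \<comment> \<open>At \<open>j = 0\<close> the truncated exponent \<open>j - 1\<close> is harmless,
    since its coefficient is zero.\<close>
  also have "l ^ j + real j * (l * l ^ (j - 1)) = real (Suc j) * l ^ (Suc j - 1)"
    by (cases j) (auto simp: algebra_simps)
  finally show ?case .
qed

section \<open>Entries of f(A) from the values of f and its derivative at the eigenvalues\<close>

lemma matfun_entry_sums:
  fixes A :: "real^'n^'n"
  assumes "f holomorphic_on UNIV"
  shows "(\<lambda>j. fps_nth (fps_expansion f 0) j * complex_of_real (matpow A j $ i $ k))
    sums (matfun f A $ i $ k)"
  unfolding matfun_entry[OF assms] by (rule summable_sums[OF summable_matfun_entry[OF assms]])

lemma matfun_2_eigenvalues:
  fixes A :: "real^2^2"
  assumes f: "f holomorphic_on UNIV"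
    and "l + m = A $ 1 $ 1 + A $ 2 $ 2"
    and "l * m = A $ 1 $ 1 * A $ 2 $ 2 - A $ 1 $ 2 * A $ 2 $ 1"
  shows "of_real (m - l) * matfun f A $ i $ k =
    of_real ((A - mat l) $ i $ k) * f (of_real m) - of_real ((A - mat m) $ i $ k) * f (of_real l)"
proof -
  let ?c = "fps_nth (fps_expansion f 0)"
  have "(\<lambda>j. of_real (m - l) * (?c j * of_real (matpow A j $ i $ k)))
      sums (of_real (m - l) * matfun f A $ i $ k)"
    by (intro sums_mult matfun_entry_sums f)
  moreover have "(\<lambda>j. of_real ((A - mat l) $ i $ k) * (?c j * of_real m ^ j)
        - of_real ((A - mat m) $ i $ k) * (?c j * of_real l ^ j))
      sums (of_real ((A - mat l) $ i $ k) * f (of_real m)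
        - of_real ((A - mat m) $ i $ k) * f (of_real l))"
    by (intro sums_diff sums_mult entire_power_series f)
  moreover have "of_real (m - l) * (?c j * of_real (matpow A j $ i $ k))
      = of_real ((A - mat l) $ i $ k) * (?c j * of_real m ^ j)
        - of_real ((A - mat m) $ i $ k) * (?c j * of_real l ^ j)" for j
  proof -
    have "of_real (m - l) * (?c j * of_real (matpow A j $ i $ k))
        = ?c j * of_real ((m - l) * matpow A j $ i $ k)"
      by (simp only: of_real_mult mult_ac)
    also have "\<dots> = ?c j * of_real ((A - mat l) $ i $ k * m ^ j - (A - mat m) $ i $ k * l ^ j)"
      by (simp only: matpow_2_eigenvalues[OF assms(2,3)])
    finally show ?thesis
      by (simp only: of_real_mult of_real_diff of_real_power algebra_simps)
  qed
  ultimately show ?thesis using sums_unique2 by simp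
qed

text \<open>The Taylor series of \<open>deriv f\<close> with its index shifted by one; the added
  term at \<open>j = 0\<close> vanishes.\<close>

lemma entire_deriv_power_series:
  assumes f: "f holomorphic_on UNIV"
  shows "(\<lambda>j. fps_nth (fps_expansion f 0) j * (of_nat j * z ^ (j - 1))) sums deriv f z"
proof -
  have "(\<lambda>j. fps_nth (fps_expansion (deriv f) 0) j * z ^ j) sums deriv f z"
    by (intro entire_power_series holomorphic_deriv f open_UNIV)
  moreover have "fps_nth (fps_expansion (deriv f) 0) j * z ^ j
      = fps_nth (fps_expansion f 0) (Suc j) * (of_nat (Suc j) * z ^ (Suc j - 1))" for j
    by (simp add: fps_expansion_def funpow_swap1 divide_simps del: of_nat_Suc)
  ultimately show ?thesis
    by (intro sums_Suc_imp[where f = "\<lambda>j. fps_nth (fps_expansion f 0) j * (of_nat j * z ^ (j - 1))"])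
       (simp_all only: of_nat_0 mult_zero_left mult_zero_right)
qed

lemma matfun_2_double_eigenvalue:
  fixes A :: "real^2^2"
  assumes f: "f holomorphic_on UNIV"
    and "l + l = A $ 1 $ 1 + A $ 2 $ 2"
    and "l * l = A $ 1 $ 1 * A $ 2 $ 2 - A $ 1 $ 2 * A $ 2 $ 1"
  shows "matfun f A $ i $ k =
    of_real (mat 1 $ i $ k) * f (of_real l) + of_real ((A - mat l) $ i $ k) * deriv f (of_real l)"
proof -
  let ?c = "fps_nth (fps_expansion f 0)"
  have "(\<lambda>j. of_real (mat 1 $ i $ k) * (?c j * of_real l ^ j)
        + of_real ((A - mat l) $ i $ k) * (?c j * (of_nat j * of_real l ^ (j - 1))))
      sums (of_real (mat 1 $ i $ k) * f (of_real l)
        + of_real ((A - mat l) $ i $ k) * deriv f (of_real l))"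
    by (intro sums_add sums_mult entire_power_series entire_deriv_power_series f)
  moreover have "?c j * of_real (matpow A j $ i $ k)
      = of_real (mat 1 $ i $ k) * (?c j * of_real l ^ j)
        + of_real ((A - mat l) $ i $ k) * (?c j * (of_nat j * of_real l ^ (j - 1)))" for j
    unfolding matpow_2_double_eigenvalue[OF assms(2,3)]
    by (simp only: of_real_mult of_real_add of_real_power of_real_of_nat_eq algebra_simps)
  ultimately show ?thesis using matfun_entry_sums[OF f, of A i k] sums_unique2 by simp
qed

section \<open>Consequences of (A) and (C) on the real line\<close>

lemma of_real_mult_nonneg_complex_iff:
  "c > 0 \<Longrightarrow> 0 \<le> complex_of_real c * w \<longleftrightarrow> 0 \<le> w"
  by (auto simp: less_eq_complex_def zero_le_mult_iff)

lemma of_real_mult_nonneg_complex: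
  "c \<ge> 0 \<Longrightarrow> 0 \<le> w \<Longrightarrow> 0 \<le> complex_of_real c * w"
  by (simp add: less_eq_complex_def)

text \<open>(A) in the coordinates \<open>t = x + y\<close>, \<open>s = x - y\<close>, where
  \<open>x, y \<ge> 0\<close> becomes \<open>\<bar>s\<bar> \<le> t\<close>.\<close>

lemma cond_A_incr:
  assumes "cond_A f" "\<bar>s\<bar> \<le> t"
  shows "0 \<le> f (of_real t) - f (of_real s)"
proof -
  have "(t + s) / 2 + (t - s) / 2 = t" "(t + s) / 2 - (t - s) / 2 = s"
    by (simp_all add: field_simps)
  then show ?thesis
    using assms(1)[unfolded cond_A_def, rule_format, of "(t + s) / 2" "(t - s) / 2"] assms(2)
    by (simp only: abs_le_iff) simp
qed

lemma cond_A_C_nonneg: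
  assumes A: "cond_A f" and C: "cond_C f" and "t \<ge> 0"
  shows "0 \<le> f (of_real t)"
proof -
  \<comment> \<open>On the diagonal \<open>x = y\<close>, (C) reduces to
    \<open>2 * x * f 0 \<ge> 0\<close>; the choice \<open>1 / 2\<close> makes the factor 1.\<close>
  have "0 \<le> f 0"
    using C[unfolded cond_C_def, rule_format, of "1 / 2" "1 / 2"] by simp
  also have "f 0 \<le> f (of_real t)"
    using cond_A_incr[OF A, of 0 t] \<open>t \<ge> 0\<close> by (auto simp: less_eq_complex_def)
  finally show ?thesis .
qed

text \<open>The derivative is a limit of right difference quotients, which (A) makes nonnegative,
  and the nonnegative reals are closed in the complex plane. Approach from the right also works at
  \<open>t = 0\<close>.\<close>

lemma cond_A_deriv_nonneg:
  assumes f: "f holomorphic_on UNIV" and A: "cond_A f" and "t \<ge> 0"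
  shows "0 \<le> deriv f (of_real t)"
proof -
  have "(f has_field_derivative deriv f (of_real t)) (at (of_real t))"
    using f by (auto intro: holomorphic_derivI)
  then have lim: "((\<lambda>h. (f (of_real t + h) - f (of_real t)) / h) \<longlongrightarrow> deriv f (of_real t)) (at 0)"
    by (simp add: DERIV_def)
  have "filterlim complex_of_real (at 0) (at_right 0)"
    unfolding filterlim_at
    by (auto intro!: tendsto_eq_intros simp: eventually_at_filter)
  from filterlim_compose[OF lim this]
  have "((\<lambda>h. (f (of_real t + of_real h) - f (of_real t)) / of_real h) \<longlongrightarrow> deriv f (of_real t))
      (at_right 0)" .
  moreover have "\<forall>\<^sub>F h in at_right 0.
      (f (of_real t + of_real h) - f (of_real t)) / complex_of_real h \<in> \<real>\<^sub>\<ge>\<^sub>0"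
    unfolding eventually_at_filter
  proof (intro always_eventually allI impI)
    fix h :: real assume "h \<in> {0<..}"
    then have h: "h > 0" by simp
    then have "0 \<le> of_real (1 / h) * (f (of_real (t + h)) - f (of_real t))"
      using \<open>t \<ge> 0\<close> by (intro of_real_mult_nonneg_complex cond_A_incr A) auto
    then show "(f (of_real t + of_real h) - f (of_real t)) / complex_of_real h \<in> \<real>\<^sub>\<ge>\<^sub>0"
      by (simp add: complex_nonneg_Reals_iff less_eq_complex_def)
  qed
  ultimately have "deriv f (of_real t) \<in> \<real>\<^sub>\<ge>\<^sub>0"
    by (intro Lim_in_closed_set[OF closed_nonneg_Reals_complex]) auto
  then show ?thesis by (simp add: complex_nonneg_Reals_iff less_eq_complex_def)
qed

section \<open>Necessity: test matrices with eigenvalues x + y and x - y\<close>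

lemma F2_imp_cond_A:
  assumes "f \<in> F2"
  shows "cond_A f"
  unfolding cond_A_def
proof (intro allI impI, elim conjE)
  fix x y :: real assume "x \<ge> 0" "y \<ge> 0"
  have f: "f holomorphic_on UNIV" using assms by (simp add: F2_def)
  show "0 \<le> f (of_real (x + y)) - f (of_real (x - y))"
  proof (cases "y = 0")
    case False
    \<comment> \<open>The symmetric matrix with eigenvalues \<open>x + y\<close> and
      \<open>x - y\<close>; its off-diagonal entry of \<open>f(A)\<close> is half the difference in
      (A).\<close>
    define A :: "real^2^2" where "A = vector [vector [x, y], vector [y, x]]"
    have A: "A $ 1 $ 1 = x" "A $ 1 $ 2 = y" "A $ 2 $ 1 = y" "A $ 2 $ 2 = x"
      by (simp_all add: A_def)
    have "0 \<le> matfun f A $ 1 $ 2"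
      using assms \<open>x \<ge> 0\<close> \<open>y \<ge> 0\<close> by (simp add: F2_def forall_2 A)
    then have "0 \<le> of_real ((x + y) - (x - y)) * matfun f A $ 1 $ 2"
      using \<open>y \<ge> 0\<close> by (intro of_real_mult_nonneg_complex) auto
    also have "\<dots> = of_real y * (f (of_real (x + y)) - f (of_real (x - y)))"
      by (subst matfun_2_eigenvalues[OF f]) (auto simp: A mat_def algebra_simps)
    finally show ?thesis
      using False \<open>y \<ge> 0\<close> by (subst (asm) of_real_mult_nonneg_complex_iff) auto
  qed simp
qed

lemma F2_imp_cond_B:
  assumes "f \<in> F2"
  shows "cond_B f"
  unfolding cond_B_def
proof (intro allI impI, elim conjE)
  fix x y z :: real assume xyz: "z \<le> x" "0 \<le> z" "x - z \<le> y"
  have f: "f holomorphic_on UNIV" using assms by (simp add: F2_def)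
  \<comment> \<open>The entry \<open>2 * x - z\<close> makes the trace \<open>2 * x\<close>, and the
    lower left entry makes the determinant \<open>x\<^sup>2 - y\<^sup>2\<close>, so the eigenvalues
    are again \<open>x + y\<close> and \<open>x - y\<close>.\<close>
  define A :: "real^2^2" where
    "A = vector [vector [z, 1], vector [y\<^sup>2 - (x - z)\<^sup>2, 2 * x - z]]"
  have A: "A $ 1 $ 1 = z" "A $ 1 $ 2 = 1" "A $ 2 $ 1 = y\<^sup>2 - (x - z)\<^sup>2" "A $ 2 $ 2 = 2 * x - z"
    by (simp_all add: A_def)
  have "(x - z)\<^sup>2 \<le> y\<^sup>2" using xyz by (intro power_mono) auto
  then have "0 \<le> matfun f A $ 1 $ 1"
    using assms xyz by (simp add: F2_def forall_2 A)
  then have "0 \<le> of_real ((x + y) - (x - y)) * matfun f A $ 1 $ 1"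
    using xyz by (intro of_real_mult_nonneg_complex) auto
  also have "\<dots> = of_real (x + y - z) * f (of_real (x - y)) + of_real (z - x + y) * f (of_real (x + y))"
    by (subst matfun_2_eigenvalues[OF f])
       (auto simp: A mat_def algebra_simps power2_eq_square)
  finally show "0 \<le> \<dots>" .
qed

lemma cond_B_imp_cond_C: "cond_B f \<Longrightarrow> cond_C f"
  unfolding cond_B_def cond_C_def
proof (intro allI impI, elim conjE)
  fix x y :: real
  assume B: "\<forall>x y z. z \<le> x \<and> 0 \<le> z \<and> x - z \<le> y \<longrightarrow>
      0 \<le> of_real (x + y - z) * f (of_real (x - y)) + of_real (z - x + y) * f (of_real (x + y))"
    and "x \<le> y" "0 \<le> x"
  then show "0 \<le> of_real (x + y) * f (of_real (x - y)) + of_real (y - x) * f (of_real (x + y))"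
    using B[rule_format, of 0 x y] by simp
qed

section \<open>Sufficiency of (A) and (C)\<close>

text \<open>The inequality of (B) without its bound \<open>z \<le> x\<close>: it must serve both
  diagonal entries of a matrix, and one of them may exceed their mean \<open>x\<close>.\<close>

lemma cond_A_C_imp_diag:
  assumes A: "cond_A f" and C: "cond_C f" and "0 \<le> x" "0 \<le> z" "x - z \<le> y" "0 \<le> y"
  shows "0 \<le> of_real (x + y - z) * f (of_real (x - y)) + of_real (z - x + y) * f (of_real (x + y))"
proof (cases "x \<le> y")
  case True
  \<comment> \<open>The value at \<open>z = 0\<close> plus \<open>z\<close> times the slope.\<close>
  have "0 \<le> (of_real (x + y) * f (of_real (x - y)) + of_real (y - x) * f (of_real (x + y)))
      + of_real z * (f (of_real (x + y)) - f (of_real (x - y)))"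
    using True assms
    by (intro add_nonneg_nonneg[OF C[unfolded cond_C_def, rule_format]]
        of_real_mult_nonneg_complex cond_A_incr) auto
  then show ?thesis by (simp add: algebra_simps)
next
  case False
  \<comment> \<open>The value at \<open>z = x - y\<close>, plus the slope times the distance of
    \<open>z\<close> from there.\<close>
  have "0 \<le> of_real (2 * y) * f (of_real (x - y))
      + of_real (z - x + y) * (f (of_real (x + y)) - f (of_real (x - y)))"
    using False assms
    by (intro add_nonneg_nonneg[where 'a = complex] of_real_mult_nonneg_complex cond_A_incr
        cond_A_C_nonneg) auto
  then show ?thesis by (simp add: algebra_simps)
qed

lemma cond_A_C_imp_F2:
  assumes f: "f holomorphic_on UNIV" and fA: "cond_A f" and fC: "cond_C f"
  shows "f \<in> F2"
proof -
  have "0 \<le> matfun f A $ i $ k" if A: "\<And>i k. 0 \<le> A $ i $ k" for A :: "real^2^2" and i k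
  proof -
    define x where "x = (A $ 1 $ 1 + A $ 2 $ 2) / 2"
    \<comment> \<open>A quarter of the discriminant of the characteristic polynomial.\<close>
    define D where "D = ((A $ 1 $ 1 - A $ 2 $ 2) / 2)\<^sup>2 + A $ 1 $ 2 * A $ 2 $ 1"
    define y where "y = sqrt D"
    have x: "0 \<le> x" using A by (simp add: x_def)
    have D: "0 \<le> D" using A by (simp add: D_def)
    then have y: "0 \<le> y" and y2: "y * y = D" by (simp_all add: y_def)
    have tr: "(x - y) + (x + y) = A $ 1 $ 1 + A $ 2 $ 2" by (simp add: x_def)
    have "(x - y) * (x + y) = x * x - D" by (simp add: algebra_simps y2)
    then have det: "(x - y) * (x + y) = A $ 1 $ 1 * A $ 2 $ 2 - A $ 1 $ 2 * A $ 2 $ 1"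
      by (simp add: x_def D_def power2_eq_square field_simps)
    have "\<bar>(A $ 1 $ 1 - A $ 2 $ 2) / 2\<bar> \<le> y"
      unfolding y_def by (rule real_le_rsqrt) (use A in \<open>simp add: D_def power_divide\<close>)
    then have diag: "x - A $ h $ h \<le> y" for h
      using exhaust_2[of h] by (auto simp: x_def)
    show ?thesis
    proof (cases "y = 0")
      case True
      \<comment> \<open>A double eigenvalue forces equal diagonal entries, so
        \<open>A - mat x\<close> is zero on the diagonal and agrees with \<open>A\<close> off
        it.\<close>
      have "A $ 1 $ 1 = x" "A $ 2 $ 2 = x"
        using diag[of 1] diag[of 2] True by (simp_all add: x_def)
      then have "0 \<le> (A - mat x) $ i $ k"
        using A[of i k] exhaust_2[of i] exhaust_2[of k] by (auto simp: mat_def)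
      moreover have "0 \<le> (mat 1 :: real^2^2) $ i $ k" by (simp add: mat_def)
      moreover have "matfun f A $ i $ k = of_real (mat 1 $ i $ k) * f (of_real x)
          + of_real ((A - mat x) $ i $ k) * deriv f (of_real x)"
        using tr det True by (intro matfun_2_double_eigenvalue f) simp_all
      ultimately show ?thesis
        using x by (metis add_nonneg_nonneg of_real_mult_nonneg_complex
          cond_A_C_nonneg[OF fA fC] cond_A_deriv_nonneg[OF f fA])
    next
      case False
      have "0 \<le> of_real ((A - mat (x - y)) $ i $ k) * f (of_real (x + y))
          - of_real ((A - mat (x + y)) $ i $ k) * f (of_real (x - y))"
      proof (cases "i = k")
        case True
        then show ?thesis
          using cond_A_C_imp_diag[OF fA fC x A[of i i] diag y]
          by (simp add: mat_def algebra_simps)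
      next
        case False
        have "0 \<le> of_real (A $ i $ k) * (f (of_real (x + y)) - f (of_real (x - y)))"
          using A x y by (intro of_real_mult_nonneg_complex cond_A_incr fA) auto
        then show ?thesis using False by (simp add: mat_def algebra_simps)
      qed
      then have "0 \<le> of_real ((x + y) - (x - y)) * matfun f A $ i $ k"
        by (subst matfun_2_eigenvalues[OF f tr det])
      then show ?thesis
        using False y by (subst (asm) of_real_mult_nonneg_complex_iff) auto
    qed
  qed
  then show ?thesis using f by (simp add: F2_def)
qed

theorem theorem13:
  fixes f :: "complex \<Rightarrow> complex"
  assumes "f holomorphic_on UNIV"
  shows "(f \<in> F2 \<longleftrightarrow> cond_A f \<and> cond_B f) \<and> (f \<in> F2 \<longleftrightarrow> cond_A f \<and> cond_C f)"
  \<comment> \<open>The cycle from \<open>F2\<close> to (A) and (B), to (A) and (C), and back to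
    \<open>F2\<close>.\<close>
  using F2_imp_cond_A F2_imp_cond_B cond_B_imp_cond_C cond_A_C_imp_F2[OF assms] by blast

end
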